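(* Let $D\subseteq\mathbb{C}$ be open and simply connected, let $u=u(z)$ be a given complex-valued function on $D$, and let $N\ge 1$. Let $\psi(j)$, $j=0,1,\ldots,N$, be formal solutions in $D$ of the generalized analytic function equation $$\partial_{\bar z}\psi=u\,\overline{\psi},$$ and let $\psi^+(j)$, $j=0,1,\ldots,N$, be formal solutions in $D$ of the conjugate equation $$\partial_{\bar z}\psi^+=-\overline{u}\,\overline{\psi^+}.$$ For $0\le j,k\le N$ with $(j,k)\ne(0,0)$ let $\omega_{j,k}$ be purely imaginary-valued functions on $D$ with $$\partial_z\omega_{j,k}=\psi(j)\,\psi^+(k),\qquad \partial_{\bar z}\omega_{j,k}=-\overline{\psi(j)\,\psi^+(k)}\quad\text{in } D$$ (with arbitrary choices of the imaginary integration constants). Let $\Omega$ be the $N\times N$ matrix-valued function whose entry in row $k$ and column $j$ is $\Omega_{k,j}=\omega_{j,k}$, $1\le j,k\le N$, and suppose $\det\Omega\ne0$ in $D$. Define $$\tilde u=u+\begin{bmatrix}\psi(1)&\ldots&\psi(N)\end{bmatrix}\Omega^{-1}\begin{bmatrix}\overline{\psi^+(1)}\\ \vdots\\ \overline{\psi^+(N)}\end{bmatrix},$$ $$\tilde\psi(0)=\psi(0)-\begin{bmatrix}\psi(1)&\ldots&\psi(N)\end{bmatrix}\Omega^{-1}\begin{bmatrix}\omega_{0,1}\\ \vdots\\ \omega_{0,N}\end{bmatrix},$$ $$\tilde\psi^+(0)=\psi^+(0)-\begin{bmatrix}\psi^+(1)&\ldots&\psi^+(N)\end{bmatrix}(\Omega^{-1})^t\begin{bmatrix}\omega_{1,0}\\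 \vdots\\ \omega_{N,0}\end{bmatrix},$$ where $t$ denotes matrix transposition. Then $$\partial_{\bar z}\tilde\psi(0)=\tilde u\,\overline{\tilde\psi(0)}\quad\text{and}\quad \partial_{\bar z}\tilde\psi^+(0)=-\overline{\tilde u}\,\overline{\tilde\psi^+(0)}\quad\text{in } D.$$
   Context: Here $\partial_z=\frac12(\partial_x-i\partial_y)$ and $\partial_{\bar z}=\frac12(\partial_x+i\partial_y)$ for $z=x+iy$. The notation $f=f(z)$ does not mean that $f$ is holomorphic. The index $j$ in $\psi(j)=\psi(z,j)$, $\psi^+(j)=\psi^+(z,j)$ labels different solutions. "Formal solution" means a function satisfying the stated equation, with no function-space or growth assumptions; it may be read as: a complex-valued function on $D$, differentiable in the real sense, satisfying the equation pointwise in $D$ (and $\omega_{j,k}$ likewise differentiable in the real sense). *)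

theory Defs
  imports "HOL-Analysis.Analysis" "Jordan_Normal_Form.Gauss_Jordan_Elimination"
    "Jordan_Normal_Form.Determinant"
begin

text \<open>
  Functions on an open set \<open>D\<close> are total functions \<open>complex \<Rightarrow> complex\<close> of which only the
  values on \<open>D\<close> matter. Differentiability is real differentiability, so that
  \<open>frechet_derivative f (at z) 1\<close> and \<open>frechet_derivative f (at z) \<i>\<close> are the partial
  derivatives with respect to \<open>x\<close> and \<open>y\<close>, where \<open>z = x + i y\<close>. The two operators below
  are meaningful only at points where \<open>f\<close> is differentiable.
\<close>

definition d_z :: "(complex \<Rightarrow> complex) \<Rightarrow> complex \<Rightarrow> complex" where
  "d_z f z = (1/2) * (frechet_derivative f (at z) 1 - \<i> * frechet_derivative f (at z) \<i>)"

definition d_zbar :: "(complex \<Rightarrow> complex) \<Rightarrow> complex \<Rightarrow> complex" where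
  "d_zbar f z = (1/2) * (frechet_derivative f (at z) 1 + \<i> * frechet_derivative f (at z) \<i>)"

text \<open>
  The conjugate equation is the same equation with coefficient \<open>\<lambda>z. - cnj (u z)\<close>.
\<close>

definition gen_analytic_solution ::
    "complex set \<Rightarrow> (complex \<Rightarrow> complex) \<Rightarrow> (complex \<Rightarrow> complex) \<Rightarrow> bool" where
  "gen_analytic_solution D u f \<longleftrightarrow>
     (\<forall>z\<in>D. f differentiable (at z) \<and> d_zbar f z = u z * cnj (f z))"

definition imaginary_potential ::
    "complex set \<Rightarrow> (complex \<Rightarrow> complex) \<Rightarrow> (complex \<Rightarrow> complex) \<Rightarrow> (complex \<Rightarrow> complex) \<Rightarrow> bool"
  where
  "imaginary_potential D f g w \<longleftrightarrow>
     (\<forall>z\<in>D. Re (w z) = 0 \<and> w differentiable (at z) \<and>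
        d_z w z = f z * g z \<and> d_zbar w z = - cnj (f z * g z))"

text \<open>
  Vectors and matrices are indexed from 0, so the mathematical index \<open>j\<close> in \<open>1..N\<close> is position
  \<open>j - 1\<close>. Row \<open>k\<close> and column \<open>j\<close> of \<open>\<Omega>\<close> hold \<open>\<omega>\<^sub>j\<^sub>,\<^sub>k\<close>, so the two indices are swapped.
\<close>

definition Omega_mat ::
    "nat \<Rightarrow> (nat \<Rightarrow> nat \<Rightarrow> complex \<Rightarrow> complex) \<Rightarrow> complex \<Rightarrow> complex mat" where
  "Omega_mat N \<omega> z = mat N N (\<lambda>(k, j). \<omega> (Suc j) (Suc k) z)"

text \<open>
  \<open>mat_inverse\<close> is \<open>Some\<close> of the inverse for an invertible square matrix and \<open>None\<close> otherwise;
  the value below is used only where \<open>\<Omega>\<close> has nonzero determinant.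
\<close>

definition Omega_inv ::
    "nat \<Rightarrow> (nat \<Rightarrow> nat \<Rightarrow> complex \<Rightarrow> complex) \<Rightarrow> complex \<Rightarrow> complex mat" where
  "Omega_inv N \<omega> z = the (mat_inverse (Omega_mat N \<omega> z))"

text \<open>
  Here \<open>scalar_prod\<close> is the bilinear product (no conjugation), that is, row vector times
  column vector.
\<close>

definition u_tilde ::
    "nat \<Rightarrow> (complex \<Rightarrow> complex) \<Rightarrow> (nat \<Rightarrow> complex \<Rightarrow> complex) \<Rightarrow> (nat \<Rightarrow> complex \<Rightarrow> complex) \<Rightarrow>
     (nat \<Rightarrow> nat \<Rightarrow> complex \<Rightarrow> complex) \<Rightarrow> complex \<Rightarrow> complex" where
  "u_tilde N u \<psi> \<psi>p \<omega> z = u z +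
     scalar_prod (vec N (\<lambda>j. \<psi> (Suc j) z))
       (Omega_inv N \<omega> z *\<^sub>v vec N (\<lambda>k. cnj (\<psi>p (Suc k) z)))"

definition psi_tilde ::
    "nat \<Rightarrow> (nat \<Rightarrow> complex \<Rightarrow> complex) \<Rightarrow> (nat \<Rightarrow> nat \<Rightarrow> complex \<Rightarrow> complex) \<Rightarrow> complex \<Rightarrow> complex" where
  "psi_tilde N \<psi> \<omega> z = \<psi> 0 z -
     scalar_prod (vec N (\<lambda>j. \<psi> (Suc j) z))
       (Omega_inv N \<omega> z *\<^sub>v vec N (\<lambda>k. \<omega> 0 (Suc k) z))"

definition psi_plus_tilde ::
    "nat \<Rightarrow> (nat \<Rightarrow> complex \<Rightarrow> complex) \<Rightarrow> (nat \<Rightarrow> nat \<Rightarrow> complex \<Rightarrow> complex) \<Rightarrow> complex \<Rightarrow> complex" where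
  "psi_plus_tilde N \<psi>p \<omega> z = \<psi>p 0 z -
     scalar_prod (vec N (\<lambda>k. \<psi>p (Suc k) z))
       (transpose_mat (Omega_inv N \<omega> z) *\<^sub>v vec N (\<lambda>j. \<omega> (Suc j) 0 z))"

end

theory Submission
  imports Defs
begin

text \<open>
  Write \<open>p\<close> for the row of the \<open>\<psi>(j)\<close>, \<open>q\<close> for the column of the \<open>\<psi>\<^sup>+(k)\<close>, \<open>A = \<Omega>\<^sup>-\<^sup>1\<close>, and \<open>w\<^sub>0\<close> for
  the column of the \<open>\<omega>\<^sub>0\<^sub>,\<^sub>k\<close>, with \<open>1 \<le> j, k \<le> N\<close>. A bar is complex conjugation and \<open>d\<close> is the
  derivative in \<open>z\<close>-bar. The transform is \<open>\<psi>(0) - p A w\<^sub>0\<close>, and the new coefficient is \<open>u + s\<close> with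
  \<open>s = p A bar q\<close>. Two facts about \<open>A\<close> make the new equation hold.

  First, \<open>d \<Omega> = - (bar q) (bar p)\<close> is a column times a row, so \<open>d A = - A (d \<Omega>) A = (A bar q) (bar p A)\<close>.
  Hence the term \<open>p (d A) w\<^sub>0\<close> of the derivative factorizes as \<open>s (bar p A w\<^sub>0)\<close>; likewise
  \<open>d w\<^sub>0 = - (bar q) (bar \<psi>(0))\<close> makes \<open>p A (d w\<^sub>0)\<close> equal to \<open>- s (bar \<psi>(0))\<close>. Together with the
  equations of \<open>\<psi>(0)\<close> and \<open>p\<close>, the derivative of the transform is
  \<open>(u + s) (bar \<psi>(0) - bar p A w\<^sub>0)\<close>.

  Second, \<open>\<Omega>\<close> is purely imaginary, hence so is \<open>A\<close>, and \<open>A w\<^sub>0\<close> is real. The last factor is therefore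
  the conjugate of the transform, which is the claim about \<open>\<psi>(0)\<close>. This computation is
  \<open>darboux_transform_solution\<close>; \<open>d_zbar_inverse\<close> and \<open>cnj_inverse_of_imaginary\<close> supply the two facts.

  The claim about \<open>\<psi>\<^sup>+(0)\<close> is the same statement after exchanging the roles of \<open>\<psi>\<close> and \<open>\<psi>\<^sup>+\<close>, transposing
  \<open>\<omega>\<close>, and replacing \<open>u\<close> by \<open>- bar u\<close>. Since \<open>A\<close> is imaginary, the coefficient that the exchanged
  data produce is \<open>- bar (u + s)\<close>, so both transforms belong to the same new coefficient.

  What remains is analytic: the product rule may only be applied to \<open>A\<close> once its entries are known
  to be differentiable, which Cramer's rule gives (\<open>differentiable_mat_inverse\<close>).
\<close>

section \<open>Calculus of the Wirtinger derivative\<close>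

lemma d_zbar_eq:
  assumes "(f has_derivative f') (at z)"
  shows "d_zbar f z = (1/2) * (f' 1 + \<i> * f' \<i>)"
  using frechet_derivative_at[OF assms] by (simp add: d_zbar_def)

lemma d_zbar_const [simp]: "d_zbar (\<lambda>_. c) z = 0"
  using d_zbar_eq[OF has_derivative_const] by simp

lemma d_zbar_diff:
  assumes "f differentiable (at z)" "g differentiable (at z)"
  shows "d_zbar (\<lambda>x. f x - g x) z = d_zbar f z - d_zbar g z"
  using d_zbar_eq[OF has_derivative_diff[OF assms[unfolded frechet_derivative_works]]]
  by (simp add: d_zbar_def algebra_simps)

lemma d_zbar_mult:
  assumes "f differentiable (at z)" "g differentiable (at z)"
  shows "d_zbar (\<lambda>x. f x * g x) z = d_zbar f z * g z + f z * d_zbar g z"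
  using d_zbar_eq[OF has_derivative_mult[OF assms[unfolded frechet_derivative_works]]]
  by (simp add: d_zbar_def algebra_simps)

lemma d_zbar_sum:
  assumes "\<And>i. i \<in> I \<Longrightarrow> f i differentiable (at z)"
  shows "d_zbar (\<lambda>x. \<Sum>i\<in>I. f i x) z = (\<Sum>i\<in>I. d_zbar (f i) z)"
proof -
  have "((\<lambda>x. \<Sum>i\<in>I. f i x) has_derivative (\<lambda>h. \<Sum>i\<in>I. frechet_derivative (f i) (at z) h)) (at z)"
    using assms by (intro has_derivative_sum) (simp add: frechet_derivative_works)
  from d_zbar_eq[OF this] show ?thesis
    by (simp add: d_zbar_def sum_distrib_left sum.distrib distrib_left)
qed

lemma d_zbar_cong_open:
  assumes "open D" "z \<in> D" "\<And>x. x \<in> D \<Longrightarrow> f x = g x" "f differentiable (at z)"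
  shows "d_zbar f z = d_zbar g z"
proof -
  have "(g has_derivative frechet_derivative f (at z)) (at z)"
    using assms has_derivative_transform_within_open frechet_derivative_works by metis
  from d_zbar_eq[OF this] show ?thesis by (simp add: d_zbar_def)
qed

lemma differentiable_cong_open:
  assumes "open D" "z \<in> D" "\<And>x. x \<in> D \<Longrightarrow> f x = g x" "f differentiable (at z)"
  shows "g differentiable (at z)"
  using assms has_derivative_transform_within_open unfolding differentiable_def by metis

lemma differentiable_prod:
  fixes f :: "'i \<Rightarrow> complex \<Rightarrow> complex"
  assumes "\<And>i. i \<in> I \<Longrightarrow> f i differentiable (at z)"
  shows "(\<lambda>x. \<Prod>i\<in>I. f i x) differentiable (at z)"
  using assms by (induction I rule: infinite_finite_induct) (auto intro!: differentiable_mult)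

section \<open>Inverse matrices as families of entries\<close>

text \<open>
  Below, a matrix and its inverse are families \<open>w\<close> and \<open>a\<close> over an arbitrary finite index set, with
  \<open>w j k\<close> the entry of the matrix in row \<open>k\<close> and column \<open>j\<close>, and \<open>a j k\<close> the entry of the inverse in
  row \<open>j\<close> and column \<open>k\<close>. With this convention, exchanging the two indices in both families turns each
  of the two inverse relations into the other.
\<close>

lemma sum_delta_mult:
  fixes f :: "'i \<Rightarrow> complex"
  assumes "finite I" "i \<in> I"
  shows "(\<Sum>l\<in>I. (if i = l then 1 else 0) * f l) = f i"
    and "(\<Sum>l\<in>I. f l * (if l = i then 1 else 0)) = f i"
proof -
  have "(\<Sum>l\<in>I. (if i = l then 1 else 0) * f l) = (\<Sum>l\<in>I. if i = l then f l else 0)"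
    by (intro sum.cong) auto
  then show "(\<Sum>l\<in>I. (if i = l then 1 else 0) * f l) = f i" using assms by simp
  have "(\<Sum>l\<in>I. f l * (if l = i then 1 else 0)) = (\<Sum>l\<in>I. if l = i then f l else 0)"
    by (intro sum.cong) auto
  then show "(\<Sum>l\<in>I. f l * (if l = i then 1 else 0)) = f i" using assms by simp
qed

text \<open>
  The row equation \<open>x \<Omega> = y\<close> is solved by multiplying with the inverse from the right. It serves both
  as uniqueness of the inverse and to isolate the derivative of the inverse.
\<close>

lemma solve_right:
  fixes a w x y :: "'i \<Rightarrow> 'i \<Rightarrow> complex"
  assumes "finite I"
    and wa: "\<And>k l. \<lbrakk>k \<in> I; l \<in> I\<rbrakk> \<Longrightarrow> (\<Sum>j\<in>I. w j k * a j l) = (if k = l then 1 else 0)"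
    and xw: "\<And>i. i \<in> I \<Longrightarrow> (\<Sum>k\<in>I. x j k * w i k) = y j i"
    and l: "l \<in> I"
  shows "x j l = (\<Sum>i\<in>I. y j i * a i l)"
proof -
  have "(\<Sum>i\<in>I. y j i * a i l) = (\<Sum>i\<in>I. \<Sum>k\<in>I. x j k * (w i k * a i l))"
    by (intro sum.cong) (simp_all add: xw[symmetric] sum_distrib_right mult.assoc)
  also have "\<dots> = (\<Sum>k\<in>I. x j k * (\<Sum>i\<in>I. w i k * a i l))"
    by (subst sum.swap) (simp add: sum_distrib_left)
  also have "\<dots> = (\<Sum>k\<in>I. x j k * (if k = l then 1 else 0))"
    using l by (intro sum.cong) (simp_all add: wa)
  finally show ?thesis using sum_delta_mult(2)[OF assms(1) l] by simp
qed

text \<open>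
  Conjugating \<open>A \<Omega> = 1\<close> shows that \<open>- cnj A\<close> is another left inverse of the imaginary matrix \<open>\<Omega>\<close>.
\<close>

lemma cnj_inverse_of_imaginary:
  fixes a w :: "'i \<Rightarrow> 'i \<Rightarrow> complex"
  assumes "finite I"
    and aw: "\<And>j i. \<lbrakk>j \<in> I; i \<in> I\<rbrakk> \<Longrightarrow> (\<Sum>k\<in>I. a j k * w i k) = (if j = i then 1 else 0)"
    and wa: "\<And>k l. \<lbrakk>k \<in> I; l \<in> I\<rbrakk> \<Longrightarrow> (\<Sum>j\<in>I. w j k * a j l) = (if k = l then 1 else 0)"
    and im: "\<And>i k. \<lbrakk>i \<in> I; k \<in> I\<rbrakk> \<Longrightarrow> cnj (w i k) = - w i k"
    and j: "j \<in> I" and l: "l \<in> I"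
  shows "cnj (a j l) = - a j l"
proof -
  have *: "(\<Sum>k\<in>I. - cnj (a j k) * w i k) = (if j = i then 1 else 0)" if "i \<in> I" for i
  proof -
    have "(\<Sum>k\<in>I. - cnj (a j k) * w i k) = cnj (\<Sum>k\<in>I. a j k * w i k)"
      unfolding cnj_sum using that by (intro sum.cong) (simp_all add: im)
    then show ?thesis by (simp add: aw[OF j that])
  qed
  have "- cnj (a j l) = (\<Sum>i\<in>I. (if j = i then 1 else 0) * a i l)"
    using solve_right[OF assms(1) wa, where x = "\<lambda>j k. - cnj (a j k)" and j = j
        and y = "\<lambda>j i. if j = i then 1 else 0" and l = l] * l by blast
  then have "- cnj (a j l) = a j l"
    using sum_delta_mult(1)[OF assms(1) j, of "\<lambda>i. a i l"] by simp
  then show ?thesis by (metis add.inverse_inverse)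
qed

text \<open>
  Differentiating the constant \<open>A \<Omega> = 1\<close> gives \<open>(d A) \<Omega> = - A (d \<Omega>)\<close>, a row equation for each row of \<open>d A\<close>.
\<close>

lemma d_zbar_inverse:
  fixes a w :: "'i \<Rightarrow> 'i \<Rightarrow> complex \<Rightarrow> complex"
  assumes "finite I" "open D" and z: "z \<in> D"
    and aw: "\<And>j i x. \<lbrakk>j \<in> I; i \<in> I; x \<in> D\<rbrakk> \<Longrightarrow> (\<Sum>k\<in>I. a j k x * w i k x) = (if j = i then 1 else 0)"
    and wa: "\<And>k l x. \<lbrakk>k \<in> I; l \<in> I; x \<in> D\<rbrakk> \<Longrightarrow> (\<Sum>j\<in>I. w j k x * a j l x) = (if k = l then 1 else 0)"
    and da: "\<And>j k. \<lbrakk>j \<in> I; k \<in> I\<rbrakk> \<Longrightarrow> a j k differentiable (at z)"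
    and dw: "\<And>j k. \<lbrakk>j \<in> I; k \<in> I\<rbrakk> \<Longrightarrow> w j k differentiable (at z)"
    and j: "j \<in> I" and l: "l \<in> I"
  shows "d_zbar (a j l) z = - (\<Sum>i\<in>I. (\<Sum>k\<in>I. a j k z * d_zbar (w i k) z) * a i l z)"
proof -
  have *: "(\<Sum>k\<in>I. d_zbar (a j k) z * w i k z) = - (\<Sum>k\<in>I. a j k z * d_zbar (w i k) z)"
    if i: "i \<in> I" for i
  proof -
    have "0 = d_zbar (\<lambda>x. \<Sum>k\<in>I. a j k x * w i k x) z"
      using d_zbar_cong_open[OF assms(2) z, of "\<lambda>_. if j = i then 1 else 0"
          "\<lambda>x. \<Sum>k\<in>I. a j k x * w i k x"] aw[OF j i] by simp
    also have "\<dots> = (\<Sum>k\<in>I. d_zbar (\<lambda>x. a j k x * w i k x) z)"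
      using j i by (intro d_zbar_sum differentiable_mult da dw)
    also have "\<dots> = (\<Sum>k\<in>I. d_zbar (a j k) z * w i k z + a j k z * d_zbar (w i k) z)"
      using j i by (intro sum.cong refl d_zbar_mult da dw)
    finally show ?thesis by (simp add: sum.distrib eq_neg_iff_add_eq_0)
  qed
  have "d_zbar (a j l) z = (\<Sum>i\<in>I. - (\<Sum>k\<in>I. a j k z * d_zbar (w i k) z) * a i l z)"
    using solve_right[OF assms(1) wa[OF _ _ z], where x = "\<lambda>j k. d_zbar (a j k) z" and j = j
        and y = "\<lambda>j i. - (\<Sum>k\<in>I. a j k z * d_zbar (w i k) z)" and l = l] * l by blast
  then show ?thesis by (simp add: sum_negf)
qed

section \<open>The Darboux transform over an index set\<close>

text \<open>
  Each part of the derivative of \<open>p A w\<^sub>0\<close> is a product of two of the sums \<open>s\<close>, \<open>r = bar p A w\<^sub>0\<close> and the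
  factors \<open>u\<close>, \<open>bar p\<^sub>0\<close>: differentiating \<open>p\<close> gives \<open>u r\<close>, differentiating \<open>A\<close> gives \<open>s r\<close>, and
  differentiating \<open>w\<^sub>0\<close> gives \<open>- s bar p\<^sub>0\<close>. Stating this for an index set and for any \<open>q\<close> that
  has the required potentials lets one lemma serve both equations.
\<close>

lemma darboux_transform_solution:
  fixes p q w0 :: "'i \<Rightarrow> complex \<Rightarrow> complex" and a w :: "'i \<Rightarrow> 'i \<Rightarrow> complex \<Rightarrow> complex"
  assumes "finite I" "open D"
    and p0: "gen_analytic_solution D u p0"
    and p: "\<And>j. j \<in> I \<Longrightarrow> gen_analytic_solution D u (p j)"
    and w0: "\<And>k. k \<in> I \<Longrightarrow> imaginary_potential D p0 (q k) (w0 k)"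
    and w: "\<And>j k. \<lbrakk>j \<in> I; k \<in> I\<rbrakk> \<Longrightarrow> imaginary_potential D (p j) (q k) (w j k)"
    and da: "\<And>j k z. \<lbrakk>j \<in> I; k \<in> I; z \<in> D\<rbrakk> \<Longrightarrow> a j k differentiable (at z)"
    and aw: "\<And>j i x. \<lbrakk>j \<in> I; i \<in> I; x \<in> D\<rbrakk> \<Longrightarrow> (\<Sum>k\<in>I. a j k x * w i k x) = (if j = i then 1 else 0)"
    and wa: "\<And>k l x. \<lbrakk>k \<in> I; l \<in> I; x \<in> D\<rbrakk> \<Longrightarrow> (\<Sum>j\<in>I. w j k x * a j l x) = (if k = l then 1 else 0)"
  shows "gen_analytic_solution D
           (\<lambda>z. u z + (\<Sum>j\<in>I. \<Sum>k\<in>I. p j z * (a j k z * cnj (q k z))))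
           (\<lambda>z. p0 z - (\<Sum>j\<in>I. \<Sum>k\<in>I. p j z * (a j k z * w0 k z)))"
  unfolding gen_analytic_solution_def
proof (intro ballI conjI)
  fix z assume z: "z \<in> D"
  have dp0: "p0 differentiable (at z)" and ep0: "d_zbar p0 z = u z * cnj (p0 z)"
    using p0 z by (auto simp: gen_analytic_solution_def)
  have dp: "p j differentiable (at z)" and ep: "d_zbar (p j) z = u z * cnj (p j z)"
    if "j \<in> I" for j
    using p z that by (auto simp: gen_analytic_solution_def)
  have dw0: "w0 k differentiable (at z)" and ew0: "d_zbar (w0 k) z = - cnj (p0 z * q k z)"
    and iw0: "cnj (w0 k z) = - w0 k z"
    if "k \<in> I" for k
    using w0 z that by (auto simp: imaginary_potential_def complex_eq_iff)
  have dw: "w j k differentiable (at z)" and ew: "d_zbar (w j k) z = - cnj (p j z * q k z)"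
    and iw: "cnj (w j k z) = - w j k z"
    if "j \<in> I" "k \<in> I" for j k
    using w z that by (auto simp: imaginary_potential_def complex_eq_iff)
  have ia: "cnj (a j k z) = - a j k z" if "j \<in> I" "k \<in> I" for j k
    using cnj_inverse_of_imaginary[OF assms(1), of "\<lambda>j k. a j k z" "\<lambda>j k. w j k z"]
      aw wa z iw that by blast
  note da' = da[OF _ _ z]
  show "(\<lambda>z. p0 z - (\<Sum>j\<in>I. \<Sum>k\<in>I. p j z * (a j k z * w0 k z))) differentiable (at z)"
    using assms(1)
    by (intro differentiable_diff differentiable_sum differentiable_mult ballI dp0 dp da' dw0)
  define s where "s = (\<Sum>j\<in>I. \<Sum>k\<in>I. p j z * (a j k z * cnj (q k z)))"
  define r where "r = (\<Sum>i\<in>I. \<Sum>l\<in>I. cnj (p i z) * (a i l z * w0 l z))"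
  have cnj_t: "cnj (p0 z - (\<Sum>j\<in>I. \<Sum>k\<in>I. p j z * (a j k z * w0 k z))) = cnj (p0 z) - r"
    by (simp add: r_def ia iw0)
  \<comment> \<open>The derivatives of \<open>w\<close> form a column times a row, hence so do those of its inverse.\<close>
  have ea: "d_zbar (a j l) z = (\<Sum>k\<in>I. a j k z * cnj (q k z)) * (\<Sum>i\<in>I. cnj (p i z) * a i l z)"
    if j: "j \<in> I" and l: "l \<in> I" for j l
  proof -
    define g where "g = (\<Sum>k\<in>I. a j k z * cnj (q k z))"
    have "d_zbar (a j l) z = - (\<Sum>i\<in>I. (\<Sum>k\<in>I. a j k z * d_zbar (w i k) z) * a i l z)"
      by (rule d_zbar_inverse[OF assms(1,2) z aw wa da' dw j l])
    also have "\<dots> = - (\<Sum>i\<in>I. (- g * cnj (p i z)) * a i l z)"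
      unfolding g_def by (intro arg_cong[where f = uminus] sum.cong refl arg_cong2[where f = "(*)"])
        (simp add: ew sum_distrib_left sum_distrib_right sum_negf mult_ac)
    also have "\<dots> = g * (\<Sum>i\<in>I. cnj (p i z) * a i l z)"
      by (simp add: sum_negf sum_distrib_left mult_ac)
    finally show ?thesis unfolding g_def .
  qed
  have "d_zbar (\<lambda>z. p0 z - (\<Sum>j\<in>I. \<Sum>k\<in>I. p j z * (a j k z * w0 k z))) z
      = d_zbar p0 z - (\<Sum>j\<in>I. \<Sum>l\<in>I. d_zbar (\<lambda>z. p j z * (a j l z * w0 l z)) z)"
    using assms(1)
    by (simp add: d_zbar_diff d_zbar_sum differentiable_sum differentiable_mult dp0 dp da' dw0)
  also have "(\<Sum>j\<in>I. \<Sum>l\<in>I. d_zbar (\<lambda>z. p j z * (a j l z * w0 l z)) z)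
      = (\<Sum>j\<in>I. \<Sum>l\<in>I. u z * (cnj (p j z) * (a j l z * w0 l z))
           + p j z * (\<Sum>k\<in>I. a j k z * cnj (q k z)) * ((\<Sum>i\<in>I. cnj (p i z) * a i l z) * w0 l z)
           - cnj (p0 z) * (p j z * (a j l z * cnj (q l z))))"
    by (intro sum.cong refl)
      (simp add: d_zbar_mult differentiable_mult dp da' dw0 ep ea ew0 algebra_simps)
  also have "\<dots> = u z * r
      + (\<Sum>j\<in>I. p j z * (\<Sum>k\<in>I. a j k z * cnj (q k z))) * (\<Sum>l\<in>I. (\<Sum>i\<in>I. cnj (p i z) * a i l z) * w0 l z)
      - cnj (p0 z) * s"
    unfolding r_def s_def sum.distrib sum_subtractf sum_distrib_left[symmetric]
      sum_distrib_right[symmetric] by simp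
  also have "(\<Sum>j\<in>I. p j z * (\<Sum>k\<in>I. a j k z * cnj (q k z))) = s"
    by (simp add: s_def sum_distrib_left)
  also have "(\<Sum>l\<in>I. (\<Sum>i\<in>I. cnj (p i z) * a i l z) * w0 l z) = r"
    unfolding r_def by (subst sum.swap) (simp add: sum_distrib_right mult.assoc)
  finally have "d_zbar (\<lambda>z. p0 z - (\<Sum>j\<in>I. \<Sum>k\<in>I. p j z * (a j k z * w0 k z))) z
      = (u z + s) * (cnj (p0 z) - r)"
    by (simp add: ep0 algebra_simps)
  then show "d_zbar (\<lambda>z. p0 z - (\<Sum>j\<in>I. \<Sum>k\<in>I. p j z * (a j k z * w0 k z))) z
      = (u z + (\<Sum>j\<in>I. \<Sum>k\<in>I. p j z * (a j k z * cnj (q k z))))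
        * cnj (p0 z - (\<Sum>j\<in>I. \<Sum>k\<in>I. p j z * (a j k z * w0 k z)))"
    unfolding cnj_t s_def .
qed

section \<open>Differentiability of the inverse matrix\<close>

text \<open>The determinant is a polynomial in the entries, by the Leibniz formula.\<close>

lemma differentiable_det:
  fixes M :: "complex \<Rightarrow> complex mat"
  assumes M: "\<And>x. M x \<in> carrier_mat n n"
    and d: "\<And>i j. \<lbrakk>i < n; j < n\<rbrakk> \<Longrightarrow> (\<lambda>x. M x $$ (i, j)) differentiable (at z)"
  shows "(\<lambda>x. Determinant.det (M x)) differentiable (at z)"
proof -
  have "(\<lambda>x. \<Sum>\<pi> \<in> {\<pi>. \<pi> permutes {0..<n}}. signof \<pi> * (\<Prod>i = 0..<n. M x $$ (i, \<pi> i))) differentiable (at z)"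
    by (intro differentiable_sum differentiable_mult differentiable_prod ballI d)
      (auto simp: finite_permutations permutes_in_image)
  then show ?thesis
    unfolding det_def'[OF M] .
qed

text \<open>
  The inverse is computed by Gauss-Jordan elimination, whose pivots depend on the matrix
  discontinuously. The formula with the adjugate exposes the smooth dependence on the entries.
\<close>

lemma mat_inverse_eqs:
  fixes M :: "complex mat"
  assumes M: "M \<in> carrier_mat n n" and det: "Determinant.det M \<noteq> 0"
  shows "the (mat_inverse M) \<in> carrier_mat n n"
    and "the (mat_inverse M) * M = 1\<^sub>m n" and "M * the (mat_inverse M) = 1\<^sub>m n"
    and "the (mat_inverse M) = (1 / Determinant.det M) \<cdot>\<^sub>m adj_mat M"
proof -
  have "mat_inverse M \<noteq> None"
    using mat_inverse(1)[OF M, where b = "()"] det_non_zero_imp_unit[OF M det, of "()"] by blast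
  then have B: "mat_inverse M = Some (the (mat_inverse M))" by simp
  show 1: "the (mat_inverse M) \<in> carrier_mat n n"
    and 2: "the (mat_inverse M) * M = 1\<^sub>m n" and "M * the (mat_inverse M) = 1\<^sub>m n"
    using mat_inverse(2)[OF M B] by auto
  let ?C = "(1 / Determinant.det M) \<cdot>\<^sub>m adj_mat M"
  have C: "?C \<in> carrier_mat n n" using adj_mat(1)[OF M] by simp
  have "M * ?C = 1\<^sub>m n"
    using mult_smult_distrib[OF M adj_mat(1)[OF M]] adj_mat(2)[OF M] det
    by (auto intro!: eq_matI)
  then show "the (mat_inverse M) = ?C"
    using assoc_mult_mat[OF 1 M C] left_mult_one_mat[OF C] 1 2 by simp
qed

lemma differentiable_mat_inverse:
  fixes M :: "complex \<Rightarrow> complex mat"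
  assumes "open D" "z \<in> D"
    and M: "\<And>x. M x \<in> carrier_mat n n"
    and d: "\<And>i j. \<lbrakk>i < n; j < n\<rbrakk> \<Longrightarrow> (\<lambda>x. M x $$ (i, j)) differentiable (at z)"
    and det: "\<And>x. x \<in> D \<Longrightarrow> Determinant.det (M x) \<noteq> 0"
    and i: "i < n" and j: "j < n"
  shows "(\<lambda>x. the (mat_inverse (M x)) $$ (i, j)) differentiable (at z)"
proof (rule differentiable_cong_open[OF assms(1,2)])
  let ?f = "\<lambda>x. 1 / Determinant.det (M x) * ((-1) ^ (j + i) * Determinant.det (mat_delete (M x) j i))"
  have n: "n = Suc (n - 1)" using i by simp
  have "(\<lambda>x. mat_delete (M x) j i $$ (r, c)) differentiable (at z)" if "r < n - 1" "c < n - 1" for r c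
    using M that by (subst mat_delete_index[symmetric, of _ "n - 1"]) (use n i j d in \<open>auto simp: insert_index_def\<close>)
  then have "(\<lambda>x. Determinant.det (mat_delete (M x) j i)) differentiable (at z)"
    by (intro differentiable_det[where n = "n - 1"] mat_delete_carrier M)
  then show "?f differentiable (at z)"
    using det assms(2) by (intro differentiable_mult differentiable_divide differentiable_det[OF M] d) auto
  fix x assume x: "x \<in> D"
  show "?f x = the (mat_inverse (M x)) $$ (i, j)"
    unfolding mat_inverse_eqs(4)[OF M det[OF x]]
    using M[of x] i j by (simp add: adj_mat_def cofactor_def)
qed

section \<open>The transformed coefficient and solutions\<close>

lemma scalar_prod_mult_mat_vec:
  fixes A :: "complex mat"
  assumes "A \<in> carrier_mat n n"
  shows "scalar_prod (vec n f) (A *\<^sub>v vec n g) = (\<Sum>j<n. \<Sum>k<n. f j * (A $$ (j, k) * g k))"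
  using assms by (simp add: scalar_prod_def sum_distrib_left atLeast0LessThan)

theorem theorem2:
  fixes D :: "complex set"
    and u :: "complex \<Rightarrow> complex"
    and N :: nat
    and \<psi> \<psi>p :: "nat \<Rightarrow> complex \<Rightarrow> complex"
    and \<omega> :: "nat \<Rightarrow> nat \<Rightarrow> complex \<Rightarrow> complex"
  assumes "open D" and "simply_connected D"
    and "N \<ge> 1"
    and "\<And>j. j \<le> N \<Longrightarrow> gen_analytic_solution D u (\<psi> j)"
    and "\<And>j. j \<le> N \<Longrightarrow> gen_analytic_solution D (\<lambda>z. - cnj (u z)) (\<psi>p j)"
    and "\<And>j k. \<lbrakk>j \<le> N; k \<le> N; (j, k) \<noteq> (0, 0)\<rbrakk> \<Longrightarrow>
           imaginary_potential D (\<psi> j) (\<psi>p k) (\<omega> j k)"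
    and "\<And>z. z \<in> D \<Longrightarrow> Determinant.det (Omega_mat N \<omega> z) \<noteq> 0"
  shows "gen_analytic_solution D (u_tilde N u \<psi> \<psi>p \<omega>) (psi_tilde N \<psi> \<omega>)
       \<and> gen_analytic_solution D (\<lambda>z. - cnj (u_tilde N u \<psi> \<psi>p \<omega> z)) (psi_plus_tilde N \<psi>p \<omega>)"
proof -
  define a where "a j k z = Omega_inv N \<omega> z $$ (j, k)" for j k z
  let ?w = "\<lambda>j k. \<omega> (Suc j) (Suc k)"
  have Om: "Omega_mat N \<omega> z \<in> carrier_mat N N" for z by (simp add: Omega_mat_def)
  have pot: "imaginary_potential D (\<psi> (Suc j)) (\<psi>p (Suc k)) (?w j k)" if "j < N" "k < N" for j k
    using assms(6) that by simp
  have da: "a j k differentiable (at z)" if "j < N" "k < N" "z \<in> D" for j k z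
    unfolding a_def[abs_def] Omega_inv_def
  proof (rule differentiable_mat_inverse[OF assms(1) that(3) Om _ assms(7) that(1,2)])
    fix r c assume "r < N" "c < N"
    then show "(\<lambda>x. Omega_mat N \<omega> x $$ (r, c)) differentiable (at z)"
      using pot[of c r] that(3) by (simp add: Omega_mat_def imaginary_potential_def)
  qed
  have Ai: "Omega_inv N \<omega> z \<in> carrier_mat N N" if "z \<in> D" for z
    using mat_inverse_eqs(1)[OF Om assms(7)[OF that]] by (simp add: Omega_inv_def)
  have aw: "(\<Sum>k<N. a j k z * ?w i k z) = (if j = i then 1 else 0)" if "j < N" "i < N" "z \<in> D" for j i z
  proof -
    have "(Omega_inv N \<omega> z * Omega_mat N \<omega> z) $$ (j, i) = 1\<^sub>m N $$ (j, i)"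
      using mat_inverse_eqs(2)[OF Om assms(7)[OF that(3)]] by (simp add: Omega_inv_def)
    then show ?thesis
      using that Ai[OF that(3)] by (simp add: scalar_prod_def a_def Omega_mat_def atLeast0LessThan)
  qed
  have wa: "(\<Sum>j<N. ?w j k z * a j l z) = (if k = l then 1 else 0)" if "k < N" "l < N" "z \<in> D" for k l z
  proof -
    have "(Omega_mat N \<omega> z * Omega_inv N \<omega> z) $$ (k, l) = 1\<^sub>m N $$ (k, l)"
      using mat_inverse_eqs(3)[OF Om assms(7)[OF that(3)]] by (simp add: Omega_inv_def)
    then show ?thesis
      using that Ai[OF that(3)] by (simp add: scalar_prod_def a_def Omega_mat_def atLeast0LessThan)
  qed
  \<comment> \<open>Needed to identify the coefficient produced by the exchanged data.\<close>
  have ia: "cnj (a j k z) = - a j k z" if "j < N" "k < N" "z \<in> D" for j k z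
    using cnj_inverse_of_imaginary[of "{..<N}" "\<lambda>j k. a j k z" "\<lambda>j k. ?w j k z"] aw wa pot that
    by (simp add: imaginary_potential_def complex_eq_iff)
  have u_tilde: "u_tilde N u \<psi> \<psi>p \<omega> z
      = u z + (\<Sum>j<N. \<Sum>k<N. \<psi> (Suc j) z * (a j k z * cnj (\<psi>p (Suc k) z)))" if "z \<in> D" for z
    by (simp add: u_tilde_def scalar_prod_mult_mat_vec[OF Ai[OF that]] a_def)
  have psi_tilde: "psi_tilde N \<psi> \<omega> z
      = \<psi> 0 z - (\<Sum>j<N. \<Sum>k<N. \<psi> (Suc j) z * (a j k z * \<omega> 0 (Suc k) z))" if "z \<in> D" for z
    by (simp add: psi_tilde_def scalar_prod_mult_mat_vec[OF Ai[OF that]] a_def)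
  have psi_plus_tilde: "psi_plus_tilde N \<psi>p \<omega> z
      = \<psi>p 0 z - (\<Sum>k<N. \<Sum>j<N. \<psi>p (Suc k) z * (a j k z * \<omega> (Suc j) 0 z))" if "z \<in> D" for z
    using Ai[OF that]
    by (simp add: psi_plus_tilde_def scalar_prod_mult_mat_vec[where A = "transpose_mat (Omega_inv N \<omega> z)"] a_def)
  have u_plus: "- cnj (u_tilde N u \<psi> \<psi>p \<omega> z)
      = - cnj (u z) + (\<Sum>k<N. \<Sum>j<N. \<psi>p (Suc k) z * (a j k z * cnj (\<psi> (Suc j) z)))" if "z \<in> D" for z
    unfolding u_tilde[OF that] by (subst sum.swap) (simp add: ia that sum_negf mult_ac)
  have pot_swap: "imaginary_potential D g f w" if "imaginary_potential D f g w" for f g w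
    using that by (simp add: imaginary_potential_def mult.commute)
  have gen_cong: "gen_analytic_solution D v' f'"
    if "gen_analytic_solution D v f" "\<And>z. z \<in> D \<Longrightarrow> v' z = v z" "\<And>z. z \<in> D \<Longrightarrow> f' z = f z" for v v' f f'
    unfolding gen_analytic_solution_def
  proof (intro ballI conjI)
    fix z assume z: "z \<in> D"
    have d: "f differentiable (at z)" and e: "d_zbar f z = v z * cnj (f z)"
      using that(1) z by (auto simp: gen_analytic_solution_def)
    show "f' differentiable (at z)"
      using differentiable_cong_open[OF assms(1) z _ d] that(3) by simp
    show "d_zbar f' z = v' z * cnj (f' z)"
      using d_zbar_cong_open[OF assms(1) z _ d, of f'] that(2,3) z e by simp
  qed
  have "gen_analytic_solution D (u_tilde N u \<psi> \<psi>p \<omega>) (psi_tilde N \<psi> \<omega>)"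
  proof (rule gen_cong[OF darboux_transform_solution[where I = "{..<N}" and u = u and ?p0.0 = "\<psi> 0"
        and p = "\<lambda>j. \<psi> (Suc j)" and q = "\<lambda>k. \<psi>p (Suc k)" and w = ?w
        and ?w0.0 = "\<lambda>k. \<omega> 0 (Suc k)" and a = a]])
  qed (use assms(1,4,6) pot da aw wa u_tilde psi_tilde in auto)
  moreover have "gen_analytic_solution D (\<lambda>z. - cnj (u_tilde N u \<psi> \<psi>p \<omega> z)) (psi_plus_tilde N \<psi>p \<omega>)"
  proof (rule gen_cong[OF darboux_transform_solution[where I = "{..<N}" and u = "\<lambda>z. - cnj (u z)"
        and ?p0.0 = "\<psi>p 0" and p = "\<lambda>j. \<psi>p (Suc j)" and q = "\<lambda>k. \<psi> (Suc k)" and w = "\<lambda>k j. ?w j k"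
        and ?w0.0 = "\<lambda>k. \<omega> (Suc k) 0" and a = "\<lambda>k j. a j k"]])
  qed (use assms(1,5,6) pot da aw wa u_plus psi_plus_tilde in \<open>auto intro: pot_swap simp: mult.commute\<close>)
  ultimately show ?thesis ..
qed

end
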